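(* Let $\mathcal{M}$ be a circular embedding of a connected graph $X$ with $n$ vertices and $s$ faces on a closed orientable surface. Let $U$ be its vertex-face transition matrix, $C$ its vertex-face incidence matrix, and $\widehat C=\widehat N^T\widehat M$ its normalized vertex-face incidence matrix. Then the $(-1)$-eigenspace of $U$ is \[\widehat M\ker(\widehat C)\oplus\widehat N\ker(\widehat C^T),\] and it has dimension $n+s-2\operatorname{rk}(C)$.
   Context: Setting. A circular embedding is a cellular embedding in which every face is bounded by a cycle. Arcs are ordered pairs $(u,v)$ with $\{u,v\}$ an edge, and $u$ is the tail. Consistent orientation. Fix an orientation of the face boundaries such that each edge shared by two faces receives opposite directions in them. Then every arc lies in exactly one facial walk. Matrices. - $M$ is the arc-face incidence matrix ($M_{(a,b),f}=1$ iff $(a,b)$ lies in the facial walk of $f$). - $N$ is the arc-tail incidence matrix ($N_{(a,b),u}=1$ iff $a=u$). - $\widehat M,\widehat N$ are these matrices with columns scaled to unit length. - $U=(2\widehat M\widehat M^T-I)(2\widehat N\widehat N^T-I)$ is the vertex-face transition matrix. - $C$ is the $n\times s$ matrix with $C_{u,f}=1$ iff $u$ lies on face $f$; equivalently $C=N^TM$. *)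

theory Defs
  imports "Jordan_Normal_Form.DL_Rank" "Jordan_Normal_Form.Matrix_Kernel"
begin

section \<open>Combinatorial model of an embedding on a closed orientable surface\<close>

text \<open>Vertices are 0,...,n-1. The graph is simple, given by a symmetric irreflexive
edge relation E. An embedding on a closed orientable surface is encoded (Heffter-Edmonds)
by a rotation system rho: for every vertex u, rho u is a cyclic permutation of the
neighbourhood of u. Faces are the orbits of the face permutation on arcs,
phi (u,v) = (v, rho v u); these orbits are the facial walks with a consistent orientation.\<close>

definition nbrs :: "(nat \<Rightarrow> nat \<Rightarrow> bool) \<Rightarrow> nat \<Rightarrow> nat set" where
  "nbrs E u = {v. E u v}"

definition simple_graph :: "nat \<Rightarrow> (nat \<Rightarrow> nat \<Rightarrow> bool) \<Rightarrow> bool" where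
  "simple_graph n E \<longleftrightarrow> (\<forall>u v. E u v \<longrightarrow> u < n \<and> v < n \<and> u \<noteq> v \<and> E v u)"

definition connected_graph :: "nat \<Rightarrow> (nat \<Rightarrow> nat \<Rightarrow> bool) \<Rightarrow> bool" where
  "connected_graph n E \<longleftrightarrow> (\<forall>u v. u < n \<longrightarrow> v < n \<longrightarrow> E\<^sup>*\<^sup>* u v)"

definition rotation_system :: "nat \<Rightarrow> (nat \<Rightarrow> nat \<Rightarrow> bool) \<Rightarrow> (nat \<Rightarrow> nat \<Rightarrow> nat) \<Rightarrow> bool" where
  "rotation_system n E rho \<longleftrightarrow>
     (\<forall>u < n. bij_betw (rho u) (nbrs E u) (nbrs E u) \<and>
        (\<forall>v \<in> nbrs E u. \<forall>w \<in> nbrs E u. \<exists>k. (rho u ^^ k) v = w))"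

definition face_perm :: "(nat \<Rightarrow> nat \<Rightarrow> nat) \<Rightarrow> nat \<times> nat \<Rightarrow> nat \<times> nat" where
  "face_perm rho a = (snd a, rho (snd a) (fst a))"

text \<open>The arcs, as a list (fixed enumeration of the rows of M and N).\<close>
definition arcs :: "nat \<Rightarrow> (nat \<Rightarrow> nat \<Rightarrow> bool) \<Rightarrow> (nat \<times> nat) list" where
  "arcs n E = filter (\<lambda>(u,v). E u v) (List.product [0..<n] [0..<n])"

text \<open>The face (facial walk) containing arc a, as its set of arcs.\<close>
definition face_of :: "(nat \<Rightarrow> nat \<Rightarrow> nat) \<Rightarrow> nat \<times> nat \<Rightarrow> (nat \<times> nat) set" where
  "face_of rho a = {(face_perm rho ^^ k) a | k. True}"

text \<open>The faces, as a duplicate-free list (fixed enumeration of the columns of M).\<close>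
definition faces :: "nat \<Rightarrow> (nat \<Rightarrow> nat \<Rightarrow> bool) \<Rightarrow> (nat \<Rightarrow> nat \<Rightarrow> nat) \<Rightarrow> (nat \<times> nat) set list" where
  "faces n E rho = remdups (map (face_of rho) (arcs n E))"

text \<open>Circular embedding of a connected simple graph: every face is bounded by a cycle,
i.e. its facial walk has length at least 3 and visits no vertex twice. A graph without
edges has a single face that is not bounded by a cycle, hence the requirement of an edge.\<close>
definition circular_embedding :: "nat \<Rightarrow> (nat \<Rightarrow> nat \<Rightarrow> bool) \<Rightarrow> (nat \<Rightarrow> nat \<Rightarrow> nat) \<Rightarrow> bool" where
  "circular_embedding n E rho \<longleftrightarrow>
     simple_graph n E \<and> connected_graph n E \<and> rotation_system n E rho \<and>
     (\<exists>u v. E u v) \<and>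
     (\<forall>a \<in> set (arcs n E). card (face_of rho a) \<ge> 3 \<and> inj_on fst (face_of rho a))"

section \<open>Matrices\<close>

text \<open>Arc-face incidence matrix M.\<close>
definition arc_face_mat :: "nat \<Rightarrow> (nat \<Rightarrow> nat \<Rightarrow> bool) \<Rightarrow> (nat \<Rightarrow> nat \<Rightarrow> nat) \<Rightarrow> real mat" where
  "arc_face_mat n E rho = mat (length (arcs n E)) (length (faces n E rho))
     (\<lambda>(i,j). if arcs n E ! i \<in> faces n E rho ! j then 1 else 0)"

text \<open>Arc-tail incidence matrix N.\<close>
definition arc_tail_mat :: "nat \<Rightarrow> (nat \<Rightarrow> nat \<Rightarrow> bool) \<Rightarrow> real mat" where
  "arc_tail_mat n E = mat (length (arcs n E)) n
     (\<lambda>(i,u). if fst (arcs n E ! i) = u then 1 else 0)"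

text \<open>Scale every column to unit Euclidean length.\<close>
definition normalize_cols :: "real mat \<Rightarrow> real mat" where
  "normalize_cols A = mat (dim_row A) (dim_col A)
     (\<lambda>(i,j). A $$ (i,j) / sqrt (\<Sum>k < dim_row A. (A $$ (k,j))\<^sup>2))"

text \<open>Vertex-face transition matrix U.\<close>
definition transition_mat :: "nat \<Rightarrow> (nat \<Rightarrow> nat \<Rightarrow> bool) \<Rightarrow> (nat \<Rightarrow> nat \<Rightarrow> nat) \<Rightarrow> real mat" where
  "transition_mat n E rho =
    (let Mh = normalize_cols (arc_face_mat n E rho); Nh = normalize_cols (arc_tail_mat n E);
         m = length (arcs n E)
     in (2 \<cdot>\<^sub>m (Mh * transpose_mat Mh) - 1\<^sub>m m) * (2 \<cdot>\<^sub>m (Nh * transpose_mat Nh) - 1\<^sub>m m))"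

text \<open>The (-1)-eigenspace of a square matrix.\<close>
definition eigenspace_mat :: "real mat \<Rightarrow> real \<Rightarrow> real vec set" where
  "eigenspace_mat A lam = {x \<in> carrier_vec (dim_row A). A *\<^sub>v x = lam \<cdot>\<^sub>v x}"

text \<open>Dimension of a subspace W of real^m.\<close>
definition subspace_dim :: "nat \<Rightarrow> real vec set \<Rightarrow> nat" where
  "subspace_dim m W = vectorspace.dim class_ring ((module_vec TYPE(real) m)\<lparr>carrier := W\<rparr>)"

definition image_of_set :: "real mat \<Rightarrow> real vec set \<Rightarrow> real vec set" where
  "image_of_set A W = (\<lambda>y. A *\<^sub>v y) ` W"

end

theory Submission
  imports Defs
begin

text \<open>
  The normalized incidence matrices Mh and Nh have orthonormal columns: distinct faces share no
  arc, every arc has exactly one tail, and no column vanishes. So U = R_M R_N is a product of the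
  reflections R_M = 2 Mh Mh^T - I and R_N = 2 Nh Nh^T - I. Since R_M is an involution, U x = -x
  amounts to R_N x = -R_M x, i.e. x = Mh a + Nh b with a = Mh^T x and b = Nh^T x, and applying
  Mh^T and Nh^T to this decomposition shows that it holds exactly when Ch a = 0 and Ch^T b = 0.
  The map Mh^T sends the eigenspace onto ker Ch with kernel Nh (ker Ch^T), whence its dimension
  is dim ker Ch + dim ker Ch^T = n + s - 2 rk Ch. Finally Ch is C scaled on both sides by
  invertible diagonal matrices, so rk Ch = rk C.
\<close>

section \<open>Dimensions of subspaces of real vector spaces\<close>

lemma subspace_vecI:
  fixes S :: "real vec set"
  assumes "S \<subseteq> carrier_vec k" and "0\<^sub>v k \<in> S"
    and "\<And>x y. x \<in> S \<Longrightarrow> y \<in> S \<Longrightarrow> x + y \<in> S"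
    and "\<And>c x. x \<in> S \<Longrightarrow> c \<cdot>\<^sub>v x \<in> S"
  shows "subspace class_ring S (module_vec TYPE(real) k)"
proof -
  interpret V: vec_space "TYPE(real)" k .
  show ?thesis
    unfolding subspace_def
    by (intro conjI V.vectorspace_axioms submodule.intro) (use assms V.module_axioms in auto)
qed

lemma subspace_vecD:
  assumes "subspace class_ring S (module_vec TYPE(real) k)"
  shows "S \<subseteq> carrier_vec k" and "0\<^sub>v k \<in> S"
    and "x \<in> S \<Longrightarrow> y \<in> S \<Longrightarrow> x + y \<in> S" and "x \<in> S \<Longrightarrow> c \<cdot>\<^sub>v x \<in> S"
  using assms unfolding subspace_def submodule_def by (auto simp: module_vec_simps)

lemma subspace_carrier_vec: "subspace class_ring (carrier_vec k) (module_vec TYPE(real) k)"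
  by (rule subspace_vecI) auto

lemma subspace_mat_kernel:
  fixes A :: "real mat"
  assumes "A \<in> carrier_mat nr nc"
  shows "subspace class_ring (mat_kernel A) (module_vec TYPE(real) nc)"
  by (rule subspace_vecI) (use assms in \<open>auto simp: mat_kernel_def mult_add_distrib_mat_vec mult_mat_vec\<close>)

lemma subspace_eigenspace_mat:
  fixes U :: "real mat"
  assumes U: "U \<in> carrier_mat k k"
  shows "subspace class_ring (eigenspace_mat U lam) (module_vec TYPE(real) k)"
proof (rule subspace_vecI)
  fix x y assume "x \<in> eigenspace_mat U lam" "y \<in> eigenspace_mat U lam"
  then show "x + y \<in> eigenspace_mat U lam"
    using U by (auto simp: eigenspace_mat_def mult_add_distrib_mat_vec smult_add_distrib_vec)
next
  fix c x assume "x \<in> eigenspace_mat U lam"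
  then show "c \<cdot>\<^sub>v x \<in> eigenspace_mat U lam"
    using U by (auto simp: eigenspace_mat_def mult_mat_vec smult_smult_assoc mult.commute)
qed (use U in \<open>auto simp: eigenspace_mat_def\<close>)

lemma subspace_mult_mat_vec_image:
  fixes P :: "real mat"
  assumes P: "P \<in> carrier_mat r k" and S: "subspace class_ring S (module_vec TYPE(real) k)"
  shows "subspace class_ring ((*\<^sub>v) P ` S) (module_vec TYPE(real) r)"
proof (rule subspace_vecI)
  note SC = subspace_vecD[OF S]
  show "0\<^sub>v r \<in> (*\<^sub>v) P ` S"
    using SC P by (intro image_eqI[of _ _ "0\<^sub>v k"]) auto
  fix x y assume "x \<in> (*\<^sub>v) P ` S" "y \<in> (*\<^sub>v) P ` S"
  then obtain a b where "a \<in> S" "b \<in> S" "x = P *\<^sub>v a" "y = P *\<^sub>v b" by auto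
  then show "x + y \<in> (*\<^sub>v) P ` S"
    using SC P by (intro image_eqI[of _ _ "a + b"]) (auto simp: mult_add_distrib_mat_vec subset_iff)
next
  fix c x assume "x \<in> (*\<^sub>v) P ` S"
  then obtain a where "a \<in> S" "x = P *\<^sub>v a" by auto
  then show "c \<cdot>\<^sub>v x \<in> (*\<^sub>v) P ` S"
    using subspace_vecD[OF S] P by (intro image_eqI[of _ _ "c \<cdot>\<^sub>v a"]) (auto simp: mult_mat_vec subset_iff)
qed (use subspace_vecD[OF S] P in auto)

lemma fin_dim_subspace_vec:
  assumes S: "subspace class_ring S (module_vec TYPE(real) k)"
  shows "vectorspace.fin_dim class_ring ((module_vec TYPE(real) k)\<lparr>carrier := S\<rparr>)"
proof -
  interpret V: vec_space "TYPE(real)" k .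
  interpret SV: vectorspace class_ring "V.vs S" using V.subspace_is_vs[OF S] .
  have bounded: "finite A \<and> card A \<le> V.dim" if "A \<subseteq> carrier (V.vs S) \<and> SV.lin_indpt A" for A
  proof -
    have "A \<subseteq> S" using that by auto
    then have "V.lin_indpt A"
      using that V.span_li_not_depend(2)[of A S] S unfolding subspace_def by auto
    then show ?thesis using V.li_le_dim[OF V.fin_dim] \<open>A \<subseteq> S\<close> subspace_vecD[OF S] by auto
  qed
  have "\<exists>A. finite A \<and> maximal A (\<lambda>A. A \<subseteq> carrier (V.vs S) \<and> SV.lin_indpt A)"
  proof (rule maximal_exists[where N = "V.dim" and B = "{}"])
    show "\<And>A. A \<subseteq> carrier (V.vs S) \<and> SV.lin_indpt A \<Longrightarrow> finite A \<and> card A \<le> V.dim"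
      by (rule bounded)
  qed (auto simp: SV.lin_dep_def)
  then obtain A where "finite A" "maximal A (\<lambda>A. A \<subseteq> carrier (V.vs S) \<and> SV.lin_indpt A)"
    by blast
  then have "SV.basis A" by (intro SV.max_li_is_basis)
  with \<open>finite A\<close> show ?thesis unfolding SV.fin_dim_def SV.basis_def by blast
qed

lemma subspace_dim_rank_nullity:
  fixes P :: "real mat"
  assumes P: "P \<in> carrier_mat r k" and S: "subspace class_ring S (module_vec TYPE(real) k)"
  shows "subspace_dim k S = subspace_dim r ((*\<^sub>v) P ` S) + subspace_dim k {x \<in> S. P *\<^sub>v x = 0\<^sub>v r}"
proof -
  interpret V: vec_space "TYPE(real)" k .
  interpret W: vec_space "TYPE(real)" r .
  interpret SV: vectorspace class_ring "V.vs S" using V.subspace_is_vs[OF S] .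
  interpret L: linear_map class_ring "V.vs S" W.V "(*\<^sub>v) P"
    by (intro linear_map.intro SV.vectorspace_axioms W.vectorspace_axioms mod_hom.intro
        SV.module_axioms W.module_axioms)
      (use subspace_vecD[OF S] P in \<open>auto simp: mod_hom_axioms_def LinearCombinations.module_hom_def
        Pi_def mult_add_distrib_mat_vec mult_mat_vec module_vec_simps class_ring_simps subset_iff\<close>)
  have "vectorspace.dim class_ring (W.vs L.imT) + vectorspace.dim class_ring (SV.vs L.kerT) = SV.dim"
    using L.rank_nullity[OF fin_dim_subspace_vec[OF S]] .
  moreover have "L.imT = (*\<^sub>v) P ` S" unfolding L.im_def by simp
  moreover have "L.kerT = {x \<in> S. P *\<^sub>v x = 0\<^sub>v r}" unfolding L.ker_def by simp
  ultimately show ?thesis unfolding subspace_dim_def by simp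
qed

lemma subspace_dim_zero_vec: "subspace_dim k {0\<^sub>v k} = 0"
proof -
  interpret V: vec_space "TYPE(real)" k .
  show ?thesis using V.dim_zero_vs V.span_empty unfolding subspace_dim_def by simp
qed

lemma subspace_dim_carrier_vec: "subspace_dim k (carrier_vec k) = k"
proof -
  interpret V: vec_space "TYPE(real)" k .
  have "V.vs (carrier_vec k) = V.V" by (simp add: module_vec_def)
  then show ?thesis unfolding subspace_dim_def using V.dim_is_n by metis
qed

lemma subspace_dim_inj_image:
  fixes P :: "real mat"
  assumes P: "P \<in> carrier_mat r k" and S: "subspace class_ring S (module_vec TYPE(real) k)"
    and inj: "\<And>x. x \<in> S \<Longrightarrow> P *\<^sub>v x = 0\<^sub>v r \<Longrightarrow> x = 0\<^sub>v k"
  shows "subspace_dim r ((*\<^sub>v) P ` S) = subspace_dim k S"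
proof -
  have "{x \<in> S. P *\<^sub>v x = 0\<^sub>v r} = {0\<^sub>v k}" using inj P subspace_vecD(2)[OF S] by auto
  then show ?thesis using subspace_dim_rank_nullity[OF P S] subspace_dim_zero_vec by simp
qed

lemma subspace_dim_mono:
  assumes S: "subspace class_ring S (module_vec TYPE(real) k)"
    and T: "subspace class_ring T (module_vec TYPE(real) k)" and "S \<subseteq> T"
  shows "subspace_dim k S \<le> subspace_dim k T"
proof -
  interpret V: vec_space "TYPE(real)" k .
  interpret TV: vectorspace class_ring "V.vs T" using V.subspace_is_vs[OF T] .
  have "subspace class_ring S (V.vs T)" using V.nested_subspaces[OF T S \<open>S \<subseteq> T\<close>] .
  from TV.subspace_dim[OF this] fin_dim_subspace_vec[OF T] fin_dim_subspace_vec[OF S]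
  show ?thesis unfolding subspace_dim_def by simp
qed

lemma rank_eq_subspace_dim_image:
  fixes A :: "real mat"
  assumes A: "A \<in> carrier_mat r k"
  shows "vec_space.rank r A = subspace_dim r ((*\<^sub>v) A ` carrier_vec k)"
proof -
  interpret V: vec_space "TYPE(real)" r .
  have "V.col_space A = (*\<^sub>v) A ` carrier_vec k" using V.col_space_eq[OF A] A by auto
  then show ?thesis unfolding V.rank_def subspace_dim_def V.col_space_def by simp
qed

lemma rank_nullity_mat:
  fixes A :: "real mat"
  assumes A: "A \<in> carrier_mat r k"
  shows "vec_space.rank r A + subspace_dim k (mat_kernel A) = k"
proof -
  have "{x \<in> carrier_vec k. A *\<^sub>v x = 0\<^sub>v r} = mat_kernel A" using A by (auto simp: mat_kernel_def)
  then show ?thesis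
    using subspace_dim_rank_nullity[OF A subspace_carrier_vec] subspace_dim_carrier_vec
      rank_eq_subspace_dim_image[OF A] by simp
qed

lemma mat_kernel_gram:
  fixes A :: "real mat"
  assumes A: "A \<in> carrier_mat r k"
  shows "mat_kernel (transpose_mat A * A) = mat_kernel A"
proof (rule equalityI)
  show "mat_kernel A \<subseteq> mat_kernel (transpose_mat A * A)"
    by (rule mat_kernel_mult_subset[OF A]) (use A in simp)
  show "mat_kernel (transpose_mat A * A) \<subseteq> mat_kernel A"
  proof
    fix x assume "x \<in> mat_kernel (transpose_mat A * A)"
    then have x: "x \<in> carrier_vec k" and "transpose_mat A *\<^sub>v (A *\<^sub>v x) = 0\<^sub>v k"
      using A by (auto simp: mat_kernel_def assoc_mult_mat_vec)
    then have "(A *\<^sub>v x) \<bullet> (A *\<^sub>v x) = 0"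
      using transpose_vec_mult_scalar[OF A x, of "A *\<^sub>v x"] A by simp
    then have "A *\<^sub>v x = 0\<^sub>v r"
      using conjugate_square_eq_0_vec[of "A *\<^sub>v x" r] A x by simp
    then show "x \<in> mat_kernel A" using x A by (auto simp: mat_kernel_def)
  qed
qed

lemma rank_transpose_le:
  fixes A :: "real mat"
  assumes A: "A \<in> carrier_mat r k"
  shows "vec_space.rank r A \<le> vec_space.rank k (transpose_mat A)"
proof -
  have G: "transpose_mat A * A \<in> carrier_mat k k" and AT: "transpose_mat A \<in> carrier_mat k r"
    using A by auto
  have "(*\<^sub>v) (transpose_mat A * A) ` carrier_vec k \<subseteq> (*\<^sub>v) (transpose_mat A) ` carrier_vec r"
    using A by (auto simp: assoc_mult_mat_vec)
  then have "vec_space.rank k (transpose_mat A * A) \<le> vec_space.rank k (transpose_mat A)"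
    unfolding rank_eq_subspace_dim_image[OF G] rank_eq_subspace_dim_image[OF AT]
    by (intro subspace_dim_mono subspace_mult_mat_vec_image[OF G subspace_carrier_vec]
        subspace_mult_mat_vec_image[OF AT subspace_carrier_vec])
  moreover have "vec_space.rank k (transpose_mat A * A) = vec_space.rank r A"
    using rank_nullity_mat[OF G] rank_nullity_mat[OF A] mat_kernel_gram[OF A] by simp
  ultimately show ?thesis by simp
qed

lemma rank_transpose:
  fixes A :: "real mat"
  assumes A: "A \<in> carrier_mat r k"
  shows "vec_space.rank k (transpose_mat A) = vec_space.rank r A"
proof -
  have "transpose_mat A \<in> carrier_mat k r" using A by simp
  from rank_transpose_le[OF this] rank_transpose_le[OF A]
  show ?thesis by simp
qed

lemma dim_mat_kernels_transpose:
  fixes A :: "real mat"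
  assumes A: "A \<in> carrier_mat r k"
  shows "int (subspace_dim k (mat_kernel A)) + int (subspace_dim r (mat_kernel (transpose_mat A)))
    = int r + int k - 2 * int (vec_space.rank r A)"
proof -
  have "transpose_mat A \<in> carrier_mat k r" using A by simp
  with rank_nullity_mat[OF A] rank_nullity_mat[OF this] rank_transpose[OF A] show ?thesis
    by linarith
qed

section \<open>Products of two reflections\<close>

lemma smult_mat_mult_vec:
  fixes A :: "real mat"
  assumes "A \<in> carrier_mat r k" and "v \<in> carrier_vec k"
  shows "(c \<cdot>\<^sub>m A) *\<^sub>v v = c \<cdot>\<^sub>v (A *\<^sub>v v)"
  using assms by (intro eq_vecI) (auto simp: mult_mat_vec_def scalar_prod_def sum_distrib_left mult.assoc)

lemma mult_mat_zero_vec: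
  fixes A :: "'a :: semiring_0 mat"
  shows "A \<in> carrier_mat r k \<Longrightarrow> A *\<^sub>v 0\<^sub>v k = 0\<^sub>v r"
  by (intro eq_vecI) auto

lemma isometry_cancel:
  fixes A :: "real mat"
  assumes "A \<in> carrier_mat m s" and "transpose_mat A * A = 1\<^sub>m s" and "a \<in> carrier_vec s"
  shows "transpose_mat A *\<^sub>v (A *\<^sub>v a) = a"
  using assms by (simp flip: assoc_mult_mat_vec)

definition reflection_mat :: "real mat \<Rightarrow> real mat" where
  "reflection_mat A = 2 \<cdot>\<^sub>m (A * transpose_mat A) - 1\<^sub>m (dim_row A)"

lemma reflection_mat_carrier: "A \<in> carrier_mat m s \<Longrightarrow> reflection_mat A \<in> carrier_mat m m"
  unfolding reflection_mat_def by auto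

lemma reflection_mat_mult_vec:
  assumes A: "A \<in> carrier_mat m s" and y: "y \<in> carrier_vec m"
  shows "reflection_mat A *\<^sub>v y = 2 \<cdot>\<^sub>v (A *\<^sub>v (transpose_mat A *\<^sub>v y)) - y"
proof -
  have AA: "A * transpose_mat A \<in> carrier_mat m m" using A by auto
  have "reflection_mat A *\<^sub>v y = (2 \<cdot>\<^sub>m (A * transpose_mat A)) *\<^sub>v y - 1\<^sub>m m *\<^sub>v y"
    unfolding reflection_mat_def carrier_matD(1)[OF A]
    by (rule minus_mult_distrib_mat_vec) (use AA y in auto)
  then show ?thesis using smult_mat_mult_vec[OF AA y] A y by simp
qed

lemma reflection_mat_involution:
  assumes A: "A \<in> carrier_mat m s" and iso: "transpose_mat A * A = 1\<^sub>m s" and y: "y \<in> carrier_vec m"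
  shows "reflection_mat A *\<^sub>v (reflection_mat A *\<^sub>v y) = y"
proof -
  let ?p = "A *\<^sub>v (transpose_mat A *\<^sub>v y)"
  have p: "?p \<in> carrier_vec m" using A y by simp
  have "transpose_mat A *\<^sub>v (2 \<cdot>\<^sub>v ?p - y) = 2 \<cdot>\<^sub>v (transpose_mat A *\<^sub>v ?p) - transpose_mat A *\<^sub>v y"
    using A p y by (simp add: mult_minus_distrib_mat_vec mult_mat_vec)
  also have "\<dots> = transpose_mat A *\<^sub>v y"
    using isometry_cancel[OF A iso] A y by (intro eq_vecI) auto
  finally have "reflection_mat A *\<^sub>v (reflection_mat A *\<^sub>v y) = 2 \<cdot>\<^sub>v ?p - (2 \<cdot>\<^sub>v ?p - y)"
    using reflection_mat_mult_vec[OF A] p y by simp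
  also have "\<dots> = y" using p y by (intro eq_vecI) auto
  finally show ?thesis .
qed

locale isometry_pair =
  fixes A B :: "real mat" and m s n :: nat
  assumes A_carrier: "A \<in> carrier_mat m s" and B_carrier: "B \<in> carrier_mat m n"
    and A_isometry: "transpose_mat A * A = 1\<^sub>m s"
    and B_isometry: "transpose_mat B * B = 1\<^sub>m n"
begin

lemma BA_carrier: "transpose_mat B * A \<in> carrier_mat n s"
  and AB_carrier: "transpose_mat A * B \<in> carrier_mat s n"
  using A_carrier B_carrier by auto

lemma transpose_A_mult_sum:
  assumes a: "a \<in> carrier_vec s" and b: "b \<in> carrier_vec n"
  shows "transpose_mat A *\<^sub>v (A *\<^sub>v a + B *\<^sub>v b) = a + (transpose_mat A * B) *\<^sub>v b"
  using A_carrier B_carrier a b isometry_cancel[OF A_carrier A_isometry a]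
  by (simp add: mult_add_distrib_mat_vec)

lemma transpose_B_mult_sum:
  assumes a: "a \<in> carrier_vec s" and b: "b \<in> carrier_vec n"
  shows "transpose_mat B *\<^sub>v (A *\<^sub>v a + B *\<^sub>v b) = (transpose_mat B * A) *\<^sub>v a + b"
  using A_carrier B_carrier a b isometry_cancel[OF B_carrier B_isometry b]
  by (simp add: mult_add_distrib_mat_vec)

lemma minus_one_eigenvector_iff:
  "x \<in> eigenspace_mat (reflection_mat A * reflection_mat B) (-1) \<longleftrightarrow>
     x \<in> carrier_vec m \<and> A *\<^sub>v (transpose_mat A *\<^sub>v x) + B *\<^sub>v (transpose_mat B *\<^sub>v x) = x"
proof (cases "x \<in> carrier_vec m")
  case False
  then show ?thesis using A_carrier by (auto simp: eigenspace_mat_def reflection_mat_def)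
next
  case x: True
  let ?RA = "reflection_mat A" and ?RB = "reflection_mat B"
  have RA: "?RA \<in> carrier_mat m m" and RB: "?RB \<in> carrier_mat m m"
    using reflection_mat_carrier A_carrier B_carrier by auto
  have RBx: "?RB *\<^sub>v x \<in> carrier_vec m" using RB x by simp
  note involution = reflection_mat_involution[OF A_carrier A_isometry]
  have "x \<in> eigenspace_mat (?RA * ?RB) (-1) \<longleftrightarrow> ?RA *\<^sub>v (?RB *\<^sub>v x) = -1 \<cdot>\<^sub>v x"
    using x RA RB by (simp add: eigenspace_mat_def)
  also have "\<dots> \<longleftrightarrow> ?RB *\<^sub>v x = ?RA *\<^sub>v (-1 \<cdot>\<^sub>v x)"
    using involution[of "?RB *\<^sub>v x"] involution[of "-1 \<cdot>\<^sub>v x"] x RBx by auto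
  also have "\<dots> \<longleftrightarrow> 2 \<cdot>\<^sub>v (B *\<^sub>v (transpose_mat B *\<^sub>v x)) - x
      = -1 \<cdot>\<^sub>v (2 \<cdot>\<^sub>v (A *\<^sub>v (transpose_mat A *\<^sub>v x)) - x)"
    using x RA reflection_mat_mult_vec[OF A_carrier x] reflection_mat_mult_vec[OF B_carrier x]
    by (simp add: mult_mat_vec)
  also have "\<dots> \<longleftrightarrow> A *\<^sub>v (transpose_mat A *\<^sub>v x) + B *\<^sub>v (transpose_mat B *\<^sub>v x) = x"
    using x A_carrier B_carrier by (auto simp: vec_eq_iff)
  finally show ?thesis using x by simp
qed

lemma minus_one_eigenspace_eq:
  "eigenspace_mat (reflection_mat A * reflection_mat B) (-1) =
     {A *\<^sub>v a + B *\<^sub>v b | a b. a \<in> mat_kernel (transpose_mat B * A) \<and> b \<in> mat_kernel (transpose_mat A * B)}"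
  (is "?E = ?D")
proof (intro equalityI subsetI)
  fix x assume "x \<in> ?E"
  then have x: "x \<in> carrier_vec m"
    and decomp: "A *\<^sub>v (transpose_mat A *\<^sub>v x) + B *\<^sub>v (transpose_mat B *\<^sub>v x) = x"
    by (simp_all add: minus_one_eigenvector_iff)
  define a b where "a = transpose_mat A *\<^sub>v x" and "b = transpose_mat B *\<^sub>v x"
  have a: "a \<in> carrier_vec s" and b: "b \<in> carrier_vec n"
    using A_carrier B_carrier x by (simp_all add: a_def b_def)
  have "a + (transpose_mat A * B) *\<^sub>v b = a" and "(transpose_mat B * A) *\<^sub>v a + b = b"
    using transpose_A_mult_sum[OF a b] transpose_B_mult_sum[OF a b] decomp
    unfolding a_def b_def by simp_all
  then have "(transpose_mat A * B) *\<^sub>v b = 0\<^sub>v s" and "(transpose_mat B * A) *\<^sub>v a = 0\<^sub>v n"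
    using a b A_carrier B_carrier by (auto simp: vec_eq_iff)
  then have "a \<in> mat_kernel (transpose_mat B * A)" and "b \<in> mat_kernel (transpose_mat A * B)"
    using a b by (simp_all add: mat_kernel[OF BA_carrier] mat_kernel[OF AB_carrier])
  moreover have "x = A *\<^sub>v a + B *\<^sub>v b" using decomp by (simp add: a_def b_def)
  ultimately show "x \<in> ?D" by blast
next
  fix x assume "x \<in> ?D"
  then obtain a b where a: "a \<in> mat_kernel (transpose_mat B * A)"
    and b: "b \<in> mat_kernel (transpose_mat A * B)" and x: "x = A *\<^sub>v a + B *\<^sub>v b"
    by blast
  note a = mat_kernelD[OF BA_carrier a] and b = mat_kernelD[OF AB_carrier b]
  have "transpose_mat A *\<^sub>v x = a" and "transpose_mat B *\<^sub>v x = b"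
    using transpose_A_mult_sum[OF a(1) b(1)] transpose_B_mult_sum[OF a(1) b(1)] a b
    unfolding x by simp_all
  moreover have "x \<in> carrier_vec m" using a b A_carrier B_carrier unfolding x by simp
  ultimately show "x \<in> ?E" unfolding minus_one_eigenvector_iff x by simp
qed

lemma zero_vec_mem_kernels:
  "0\<^sub>v s \<in> mat_kernel (transpose_mat B * A)" "0\<^sub>v n \<in> mat_kernel (transpose_mat A * B)"
  by (simp_all add: mat_kernel[OF BA_carrier] mat_kernel[OF AB_carrier]
      mult_mat_zero_vec[OF BA_carrier] mult_mat_zero_vec[OF AB_carrier])

lemma minus_one_eigenspace_summands_inter:
  "(*\<^sub>v) A ` mat_kernel (transpose_mat B * A) \<inter> (*\<^sub>v) B ` mat_kernel (transpose_mat A * B) = {0\<^sub>v m}"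
proof (intro equalityI subsetI)
  fix x
  assume "x \<in> (*\<^sub>v) A ` mat_kernel (transpose_mat B * A) \<inter> (*\<^sub>v) B ` mat_kernel (transpose_mat A * B)"
  then obtain a b where a: "a \<in> mat_kernel (transpose_mat B * A)"
    and b: "b \<in> mat_kernel (transpose_mat A * B)"
    and xa: "x = A *\<^sub>v a" and xb: "x = B *\<^sub>v b"
    by blast
  note a = mat_kernelD[OF BA_carrier a] and b = mat_kernelD[OF AB_carrier b]
  have "b = transpose_mat B *\<^sub>v x" using xb isometry_cancel[OF B_carrier B_isometry b(1)] by simp
  also have "\<dots> = 0\<^sub>v n" using xa a(2) A_carrier B_carrier a(1) by simp
  finally show "x \<in> {0\<^sub>v m}" using xb mult_mat_zero_vec[OF B_carrier] by simp
next
  fix x :: "real vec" assume "x \<in> {0\<^sub>v m}"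
  then have "x = A *\<^sub>v 0\<^sub>v s" and "x = B *\<^sub>v 0\<^sub>v n"
    using mult_mat_zero_vec[OF A_carrier] mult_mat_zero_vec[OF B_carrier] by simp_all
  with zero_vec_mem_kernels
  show "x \<in> (*\<^sub>v) A ` mat_kernel (transpose_mat B * A) \<inter> (*\<^sub>v) B ` mat_kernel (transpose_mat A * B)"
    by blast
qed

lemma transpose_A_mult_kernels_sum:
  assumes "a \<in> mat_kernel (transpose_mat B * A)" and "b \<in> mat_kernel (transpose_mat A * B)"
  shows "transpose_mat A *\<^sub>v (A *\<^sub>v a + B *\<^sub>v b) = a"
  using transpose_A_mult_sum mat_kernelD[OF BA_carrier assms(1)] mat_kernelD[OF AB_carrier assms(2)]
  by simp

lemma minus_one_eigenspace_image:
  "(*\<^sub>v) (transpose_mat A) ` eigenspace_mat (reflection_mat A * reflection_mat B) (-1)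
    = mat_kernel (transpose_mat B * A)"
proof (intro equalityI subsetI)
  fix y assume "y \<in> (*\<^sub>v) (transpose_mat A) ` eigenspace_mat (reflection_mat A * reflection_mat B) (-1)"
  then show "y \<in> mat_kernel (transpose_mat B * A)"
    unfolding minus_one_eigenspace_eq using transpose_A_mult_kernels_sum by auto
next
  fix a assume a: "a \<in> mat_kernel (transpose_mat B * A)"
  have "A *\<^sub>v a + B *\<^sub>v 0\<^sub>v n \<in> eigenspace_mat (reflection_mat A * reflection_mat B) (-1)"
    unfolding minus_one_eigenspace_eq using a zero_vec_mem_kernels by blast
  with transpose_A_mult_kernels_sum[OF a zero_vec_mem_kernels(2)]
  show "a \<in> (*\<^sub>v) (transpose_mat A) ` eigenspace_mat (reflection_mat A * reflection_mat B) (-1)"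
    by (metis image_eqI)
qed

lemma minus_one_eigenspace_kernel:
  "{x \<in> eigenspace_mat (reflection_mat A * reflection_mat B) (-1). transpose_mat A *\<^sub>v x = 0\<^sub>v s}
    = (*\<^sub>v) B ` mat_kernel (transpose_mat A * B)"
  (is "?K = _")
proof -
  have B_only: "A *\<^sub>v 0\<^sub>v s + B *\<^sub>v b = B *\<^sub>v b" if "b \<in> mat_kernel (transpose_mat A * B)" for b
    using mat_kernelD(1)[OF AB_carrier that] A_carrier B_carrier by (simp add: mult_mat_zero_vec)
  show ?thesis
  proof (intro equalityI subsetI)
    fix x assume "x \<in> ?K"
    then obtain a b where "a \<in> mat_kernel (transpose_mat B * A)" "b \<in> mat_kernel (transpose_mat A * B)"
      and "x = A *\<^sub>v a + B *\<^sub>v b" "transpose_mat A *\<^sub>v x = 0\<^sub>v s"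
      unfolding minus_one_eigenspace_eq by blast
    with transpose_A_mult_kernels_sum B_only show "x \<in> (*\<^sub>v) B ` mat_kernel (transpose_mat A * B)"
      by auto
  next
    fix x assume "x \<in> (*\<^sub>v) B ` mat_kernel (transpose_mat A * B)"
    then obtain b where b: "b \<in> mat_kernel (transpose_mat A * B)" and x: "x = A *\<^sub>v 0\<^sub>v s + B *\<^sub>v b"
      using B_only by auto
    then have "x \<in> eigenspace_mat (reflection_mat A * reflection_mat B) (-1)"
      unfolding minus_one_eigenspace_eq using zero_vec_mem_kernels by blast
    with transpose_A_mult_kernels_sum[OF zero_vec_mem_kernels(1) b] x show "x \<in> ?K"
      by simp
  qed
qed

lemma minus_one_eigenspace_dim:
  "subspace_dim m (eigenspace_mat (reflection_mat A * reflection_mat B) (-1)) =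
     subspace_dim s (mat_kernel (transpose_mat B * A)) + subspace_dim n (mat_kernel (transpose_mat A * B))"
proof -
  have AT: "transpose_mat A \<in> carrier_mat s m" using A_carrier by simp
  note E = subspace_eigenspace_mat[OF mult_carrier_mat[OF
        reflection_mat_carrier[OF A_carrier] reflection_mat_carrier[OF B_carrier]]]
  have "subspace_dim m ((*\<^sub>v) B ` mat_kernel (transpose_mat A * B))
      = subspace_dim n (mat_kernel (transpose_mat A * B))"
  proof (rule subspace_dim_inj_image[OF B_carrier subspace_mat_kernel[OF AB_carrier]])
    fix b assume b: "b \<in> mat_kernel (transpose_mat A * B)" and "B *\<^sub>v b = 0\<^sub>v m"
    have "b = transpose_mat B *\<^sub>v (B *\<^sub>v b)"
      using isometry_cancel[OF B_carrier B_isometry mat_kernelD(1)[OF AB_carrier b]] by simp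
    also have "\<dots> = 0\<^sub>v n" using \<open>B *\<^sub>v b = 0\<^sub>v m\<close> B_carrier by (simp add: mult_mat_zero_vec)
    finally show "b = 0\<^sub>v n" .
  qed
  then show ?thesis
    using subspace_dim_rank_nullity[OF AT E] minus_one_eigenspace_image minus_one_eigenspace_kernel
    by simp
qed

end

section \<open>Normalized columns\<close>

lemma mat_diag_eq_one_mat: "(\<And>i. i < n \<Longrightarrow> f i = 1) \<Longrightarrow> mat_diag n f = 1\<^sub>m n"
  unfolding mat_diag_def by (intro eq_matI) auto

lemma transpose_mat_diag: "transpose_mat (mat_diag n f) = mat_diag n f"
  unfolding mat_diag_def by (intro eq_matI) auto

lemma mat_diag_inverse:
  fixes f :: "nat \<Rightarrow> 'a :: field"
  assumes "\<And>i. i < n \<Longrightarrow> f i \<noteq> 0"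
  shows "mat_diag n (\<lambda>i. 1 / f i) * mat_diag n f = 1\<^sub>m n"
    and "mat_diag n f * mat_diag n (\<lambda>i. 1 / f i) = 1\<^sub>m n"
  using assms by (simp_all add: mat_diag_eq_one_mat)

lemma rank_mat_diag_scaled:
  fixes C :: "real mat"
  assumes C: "C \<in> carrier_mat r k"
    and f: "\<And>i. i < r \<Longrightarrow> f i \<noteq> 0" and g: "\<And>j. j < k \<Longrightarrow> g j \<noteq> 0"
  shows "vec_space.rank r (mat_diag r f * C * mat_diag k g) = vec_space.rank r C"
proof -
  have CG: "C * mat_diag k g \<in> carrier_mat r k" using C by simp
  have "mat_kernel (mat_diag r f * C * mat_diag k g) = mat_kernel (C * mat_diag k g)"
    using mat_kernel_mult_eq[OF CG mat_diag_dim mat_diag_dim mat_diag_inverse(1)[OF f]] C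
    by (simp add: assoc_mult_mat[OF mat_diag_dim C mat_diag_dim])
  then have "subspace_dim k (mat_kernel (mat_diag r f * C * mat_diag k g)) = subspace_dim k (mat_kernel C)"
    using mat_kernel_dim_mult_eq_right[OF C mat_diag_dim mat_diag_dim mat_diag_inverse(2)[OF g]]
    unfolding subspace_dim_def by simp
  moreover have "mat_diag r f * C * mat_diag k g \<in> carrier_mat r k"
    by (rule mult_carrier_mat[OF mult_carrier_mat[OF mat_diag_dim C] mat_diag_dim])
  ultimately show ?thesis using rank_nullity_mat[OF C] rank_nullity_mat by (metis add_right_cancel)
qed

definition col_norm :: "real mat \<Rightarrow> nat \<Rightarrow> real" where
  "col_norm X j = sqrt ((transpose_mat X * X) $$ (j, j))"

lemma col_norm_pos:
  assumes X: "X \<in> carrier_mat r k" and j: "j < k" and nonzero: "col X j \<noteq> 0\<^sub>v r"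
  shows "col_norm X j > 0"
proof -
  have c: "col X j \<in> carrier_vec r" using X j by simp
  have "(transpose_mat X * X) $$ (j, j) = col X j \<bullet> col X j" using X j by simp
  also have "\<dots> > 0" using conjugate_square_greater_0_vec[OF c] nonzero by simp
  finally show ?thesis unfolding col_norm_def by simp
qed

lemma normalize_cols_eq_mult_mat_diag:
  assumes X: "X \<in> carrier_mat r k"
  shows "normalize_cols X = X * mat_diag k (\<lambda>j. 1 / col_norm X j)"
  unfolding mat_diag_mult_right[OF X] normalize_cols_def col_norm_def
  using X by (intro eq_matI) (auto simp: scalar_prod_def lessThan_atLeast0 power2_eq_square)

lemma normalize_cols_carrier: "X \<in> carrier_mat r k \<Longrightarrow> normalize_cols X \<in> carrier_mat r k"
  unfolding normalize_cols_def by auto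

lemma transpose_normalize_cols_mult:
  assumes X: "X \<in> carrier_mat r k" and Y: "Y \<in> carrier_mat r l"
  shows "transpose_mat (normalize_cols X) * normalize_cols Y =
    mat_diag k (\<lambda>j. 1 / col_norm X j) * (transpose_mat X * Y) * mat_diag l (\<lambda>j. 1 / col_norm Y j)"
proof -
  let ?DX = "mat_diag k (\<lambda>j. 1 / col_norm X j)" and ?DY = "mat_diag l (\<lambda>j. 1 / col_norm Y j)"
  have XT: "transpose_mat X \<in> carrier_mat k r" using X by simp
  have "transpose_mat (X * ?DX) * (Y * ?DY) = ?DX * (transpose_mat X * (Y * ?DY))"
    using X Y by (simp add: transpose_mult[OF X mat_diag_dim] transpose_mat_diag
        assoc_mult_mat[OF mat_diag_dim XT mult_carrier_mat[OF Y mat_diag_dim]])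
  also have "\<dots> = ?DX * (transpose_mat X * Y) * ?DY"
    using X Y by (simp add: assoc_mult_mat[OF XT Y mat_diag_dim]
        assoc_mult_mat[OF mat_diag_dim mult_carrier_mat[OF XT Y] mat_diag_dim])
  finally show ?thesis
    unfolding normalize_cols_eq_mult_mat_diag[OF X] normalize_cols_eq_mult_mat_diag[OF Y] .
qed

lemma normalize_cols_isometry:
  assumes X: "X \<in> carrier_mat r k" and diag: "diagonal_mat (transpose_mat X * X)"
    and nonzero: "\<And>j. j < k \<Longrightarrow> col X j \<noteq> 0\<^sub>v r"
  shows "transpose_mat (normalize_cols X) * normalize_cols X = 1\<^sub>m k"
proof -
  let ?d = "\<lambda>j. 1 / col_norm X j"
  have gram: "transpose_mat X * X = mat_diag k (\<lambda>j. (col_norm X j)\<^sup>2)"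
  proof (rule eq_matI)
    fix i j assume "i < dim_row (mat_diag k (\<lambda>j. (col_norm X j)\<^sup>2))"
      and "j < dim_col (mat_diag k (\<lambda>j. (col_norm X j)\<^sup>2))"
    then show "(transpose_mat X * X) $$ (i, j) = mat_diag k (\<lambda>j. (col_norm X j)\<^sup>2) $$ (i, j)"
      using diag X col_norm_pos[OF X _ nonzero]
      by (auto simp: diagonal_mat_def mat_diag_def col_norm_def less_imp_le)
  qed (use X in \<open>auto simp: mat_diag_def\<close>)
  have "transpose_mat (normalize_cols X) * normalize_cols X = mat_diag k (\<lambda>j. ?d j * ((col_norm X j)\<^sup>2 * ?d j))"
    unfolding transpose_normalize_cols_mult[OF X X] gram by simp
  also have "\<dots> = 1\<^sub>m k"
  proof (rule mat_diag_eq_one_mat)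
    fix j assume "j < k"
    then have "col_norm X j \<noteq> 0" using col_norm_pos[OF X _ nonzero] by force
    then show "?d j * ((col_norm X j)\<^sup>2 * ?d j) = 1" by (simp add: power2_eq_square)
  qed
  finally show ?thesis .
qed

section \<open>Incidence matrices of circular embeddings\<close>

lemma funpow_period_on:
  assumes fin: "finite S" and closed: "f ` S \<subseteq> S" and inj: "inj_on f S" and a: "a \<in> S"
  obtains p where "p > 0" and "(f ^^ p) a = a"
proof -
  have mem: "(f ^^ j) x \<in> S" if "x \<in> S" for j x
    using that closed by (induction j) auto
  have inj_funpow: "x = y" if "x \<in> S" "y \<in> S" "(f ^^ j) x = (f ^^ j) y" for j x y
    using that
  proof (induction j arbitrary: x y)
    case (Suc j)
    then have "(f ^^ j) x = (f ^^ j) y" using inj mem by (auto dest: inj_onD)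
    with Suc show ?case by blast
  qed simp
  have "\<not> inj_on (\<lambda>j. (f ^^ j) a) {0..card S}"
  proof
    assume "inj_on (\<lambda>j. (f ^^ j) a) {0..card S}"
    moreover have "(\<lambda>j. (f ^^ j) a) ` {0..card S} \<subseteq> S" using mem a by auto
    ultimately have "card {0..card S} \<le> card S" using card_inj_on_le fin by blast
    then show False by simp
  qed
  then obtain i j where "i < j" and ij: "(f ^^ i) a = (f ^^ j) a"
    unfolding inj_on_def by (metis linorder_neqE_nat)
  have "(f ^^ i) ((f ^^ (j - i)) a) = (f ^^ (i + (j - i))) a" by (simp only: funpow_add comp_apply)
  also have "\<dots> = (f ^^ i) a" using ij \<open>i < j\<close> by simp
  finally have "(f ^^ i) ((f ^^ (j - i)) a) = (f ^^ i) a" .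
  then have "(f ^^ (j - i)) a = a" using inj_funpow mem a by blast
  with \<open>i < j\<close> show ?thesis by (intro that[of "j - i"]) auto
qed

lemma set_arcs: "simple_graph n E \<Longrightarrow> set (arcs n E) = {(u, v). E u v}"
  unfolding arcs_def simple_graph_def by auto

lemma face_perm_mem_arcs:
  assumes sg: "simple_graph n E" and rs: "rotation_system n E rho" and a: "a \<in> set (arcs n E)"
  shows "face_perm rho a \<in> set (arcs n E)"
proof -
  obtain u v where uv: "a = (u, v)" "E u v" using a set_arcs[OF sg] by auto
  then have "v < n" and "u \<in> nbrs E v" using sg unfolding simple_graph_def nbrs_def by auto
  then have "rho v u \<in> nbrs E v" using rs bij_betwE unfolding rotation_system_def by blast
  then show ?thesis using uv set_arcs[OF sg] unfolding face_perm_def nbrs_def by auto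
qed

lemma inj_on_face_perm:
  assumes sg: "simple_graph n E" and rs: "rotation_system n E rho"
  shows "inj_on (face_perm rho) (set (arcs n E))"
proof (rule inj_onI)
  fix a b assume "a \<in> set (arcs n E)" "b \<in> set (arcs n E)" and eq: "face_perm rho a = face_perm rho b"
  then obtain u v u' where a: "a = (u, v)" "E u v" and b: "b = (u', v)" "E u' v"
    and r: "rho v u = rho v u'"
    using set_arcs[OF sg] unfolding face_perm_def by auto
  have "v < n" "u \<in> nbrs E v" "u' \<in> nbrs E v" using sg a b unfolding simple_graph_def nbrs_def by auto
  then have "u = u'" using rs r unfolding rotation_system_def bij_betw_def by (auto dest: inj_onD)
  then show "a = b" using a b by simp
qed

lemma mem_face_of_self: "a \<in> face_of rho a"
  unfolding face_of_def by (auto intro: exI[of _ 0])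

lemma face_of_eq:
  assumes sg: "simple_graph n E" and rs: "rotation_system n E rho"
    and a: "a \<in> set (arcs n E)" and b: "b \<in> face_of rho a"
  shows "face_of rho b = face_of rho a"
proof -
  let ?f = "face_perm rho"
  obtain k where bk: "b = (?f ^^ k) a" using b unfolding face_of_def by auto
  obtain p where "p > 0" and p: "(?f ^^ p) a = a"
    using funpow_period_on[OF finite_set _ inj_on_face_perm[OF sg rs] a] face_perm_mem_arcs[OF sg rs]
    by blast
  have return: "(?f ^^ (p * k - k)) b = a"
  proof -
    have "(?f ^^ (p * k - k)) b = (?f ^^ (p * k - k + k)) a"
      unfolding bk by (simp only: funpow_add comp_apply)
    also have "\<dots> = (?f ^^ (p * k)) a" using \<open>p > 0\<close> by simp
    also have "\<dots> = a" using funpow_mod_eq[OF p, of "p * k"] by simp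
    finally show ?thesis .
  qed
  show ?thesis
  proof (intro equalityI subsetI)
    fix x assume "x \<in> face_of rho b"
    then obtain j where "x = (?f ^^ (j + k)) a" unfolding face_of_def bk by (auto simp: funpow_add)
    then show "x \<in> face_of rho a" unfolding face_of_def by auto
  next
    fix x assume "x \<in> face_of rho a"
    then obtain j where "x = (?f ^^ (j + (p * k - k))) b" unfolding face_of_def return[symmetric]
      by (auto simp: funpow_add)
    then show "x \<in> face_of rho b" unfolding face_of_def by auto
  qed
qed

lemma nth_faces:
  assumes "j < length (faces n E rho)"
  obtains a where "a \<in> set (arcs n E)" and "faces n E rho ! j = face_of rho a"
  using nth_mem[OF assms] unfolding faces_def by auto

lemma faces_disjoint:
  assumes sg: "simple_graph n E" and rs: "rotation_system n E rho"
    and i: "i < length (faces n E rho)" and j: "j < length (faces n E rho)" and "i \<noteq> j"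
  shows "faces n E rho ! i \<inter> faces n E rho ! j = {}"
proof (rule ccontr)
  assume "faces n E rho ! i \<inter> faces n E rho ! j \<noteq> {}"
  then obtain x where xi: "x \<in> faces n E rho ! i" and xj: "x \<in> faces n E rho ! j" by blast
  obtain a where a: "a \<in> set (arcs n E)" "faces n E rho ! i = face_of rho a" using nth_faces[OF i] .
  obtain b where b: "b \<in> set (arcs n E)" "faces n E rho ! j = face_of rho b" using nth_faces[OF j] .
  have "faces n E rho ! i = faces n E rho ! j"
    using face_of_eq[OF sg rs a(1)] face_of_eq[OF sg rs b(1)] xi xj a(2) b(2) by metis
  then show False
    using \<open>i \<noteq> j\<close> i j distinct_remdups unfolding faces_def by (simp add: nth_eq_iff_index_eq)
qed

lemma has_neighbour:
  assumes ce: "circular_embedding n E rho" and u: "u < n"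
  obtains v where "E u v"
proof -
  obtain a b where "E a b" and sg: "simple_graph n E" and cg: "connected_graph n E"
    using ce unfolding circular_embedding_def by auto
  then have "a < n" "b < n" "a \<noteq> b" unfolding simple_graph_def by auto
  then have "\<exists>v. E u v"
    using cg u unfolding connected_graph_def by (metis converse_rtranclpE)
  then show ?thesis using that by blast
qed

lemma arc_face_mat_carrier:
  "arc_face_mat n E rho \<in> carrier_mat (length (arcs n E)) (length (faces n E rho))"
  unfolding arc_face_mat_def by simp

lemma arc_tail_mat_carrier: "arc_tail_mat n E \<in> carrier_mat (length (arcs n E)) n"
  unfolding arc_tail_mat_def by simp

lemma arc_face_mat_gram_diagonal:
  assumes sg: "simple_graph n E" and rs: "rotation_system n E rho"
  shows "diagonal_mat (transpose_mat (arc_face_mat n E rho) * arc_face_mat n E rho)"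
  unfolding diagonal_mat_def
proof (intro allI impI)
  fix i j assume i: "i < dim_row (transpose_mat (arc_face_mat n E rho) * arc_face_mat n E rho)"
    and j: "j < dim_col (transpose_mat (arc_face_mat n E rho) * arc_face_mat n E rho)" and "i \<noteq> j"
  then have "faces n E rho ! i \<inter> faces n E rho ! j = {}"
    using faces_disjoint[OF sg rs] by (simp add: arc_face_mat_def)
  then show "(transpose_mat (arc_face_mat n E rho) * arc_face_mat n E rho) $$ (i, j) = 0"
    using i j by (auto simp: arc_face_mat_def scalar_prod_def intro!: sum.neutral)
qed

lemma arc_face_mat_col_nonzero:
  assumes j: "j < length (faces n E rho)"
  shows "col (arc_face_mat n E rho) j \<noteq> 0\<^sub>v (length (arcs n E))"
proof -
  obtain a where a: "a \<in> set (arcs n E)" "faces n E rho ! j = face_of rho a" using nth_faces[OF j] .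
  then obtain i where i: "i < length (arcs n E)" "arcs n E ! i = a" by (metis in_set_conv_nth)
  then have "col (arc_face_mat n E rho) j $ i = 1"
    using j a mem_face_of_self by (simp add: arc_face_mat_def)
  then show ?thesis using i by auto
qed

lemma arc_tail_mat_gram_diagonal: "diagonal_mat (transpose_mat (arc_tail_mat n E) * arc_tail_mat n E)"
  unfolding diagonal_mat_def
  by (auto simp: arc_tail_mat_def scalar_prod_def intro!: sum.neutral)

lemma arc_tail_mat_col_nonzero:
  assumes ce: "circular_embedding n E rho" and u: "u < n"
  shows "col (arc_tail_mat n E) u \<noteq> 0\<^sub>v (length (arcs n E))"
proof -
  have sg: "simple_graph n E" using ce unfolding circular_embedding_def by simp
  obtain v where "E u v" using has_neighbour[OF ce u] .
  then have "(u, v) \<in> set (arcs n E)" using set_arcs[OF sg] by simp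
  then obtain i where i: "i < length (arcs n E)" "arcs n E ! i = (u, v)" by (metis in_set_conv_nth)
  then have "col (arc_tail_mat n E) u $ i = 1" using u by (simp add: arc_tail_mat_def)
  then show ?thesis using i by auto
qed

lemma isometry_pair_normalized_incidence:
  assumes ce: "circular_embedding n E rho"
  shows "isometry_pair (normalize_cols (arc_face_mat n E rho)) (normalize_cols (arc_tail_mat n E))
    (length (arcs n E)) (length (faces n E rho)) n"
proof -
  have sg: "simple_graph n E" and rs: "rotation_system n E rho"
    using ce unfolding circular_embedding_def by auto
  show ?thesis
    using normalize_cols_carrier[OF arc_face_mat_carrier] normalize_cols_carrier[OF arc_tail_mat_carrier]
      normalize_cols_isometry[OF arc_face_mat_carrier arc_face_mat_gram_diagonal[OF sg rs]
        arc_face_mat_col_nonzero]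
      normalize_cols_isometry[OF arc_tail_mat_carrier arc_tail_mat_gram_diagonal
        arc_tail_mat_col_nonzero[OF ce]]
    by unfold_locales
qed

lemma transition_mat_eq_reflections:
  "transition_mat n E rho =
    reflection_mat (normalize_cols (arc_face_mat n E rho)) * reflection_mat (normalize_cols (arc_tail_mat n E))"
  using normalize_cols_carrier[OF arc_face_mat_carrier[of n E rho]]
    normalize_cols_carrier[OF arc_tail_mat_carrier[of n E]]
  unfolding transition_mat_def Let_def reflection_mat_def by simp

lemma rank_normalized_vertex_face_mat:
  assumes ce: "circular_embedding n E rho"
  shows "vec_space.rank n
      (transpose_mat (normalize_cols (arc_tail_mat n E)) * normalize_cols (arc_face_mat n E rho))
    = vec_space.rank n (transpose_mat (arc_tail_mat n E) * arc_face_mat n E rho)"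
proof -
  note N = arc_tail_mat_carrier[of n E] and M = arc_face_mat_carrier[of n E rho]
  have "1 / col_norm (arc_tail_mat n E) u \<noteq> 0" if "u < n" for u
    using col_norm_pos[OF N that arc_tail_mat_col_nonzero[OF ce that]] by simp
  moreover have "1 / col_norm (arc_face_mat n E rho) j \<noteq> 0" if "j < length (faces n E rho)" for j
    using col_norm_pos[OF M that arc_face_mat_col_nonzero[OF that]] by simp
  ultimately show ?thesis
    unfolding transpose_normalize_cols_mult[OF N M] using M N by (simp add: rank_mat_diag_scaled)
qed

theorem theorem3p3:
  fixes n :: nat and E :: "nat \<Rightarrow> nat \<Rightarrow> bool" and rho :: "nat \<Rightarrow> nat \<Rightarrow> nat"
  assumes "circular_embedding n E rho"
  defines "M \<equiv> arc_face_mat n E rho"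
      and "N \<equiv> arc_tail_mat n E"
      and "s \<equiv> length (faces n E rho)"
      and "m \<equiv> length (arcs n E)"
  defines "Mh \<equiv> normalize_cols M"
      and "Nh \<equiv> normalize_cols N"
      and "U \<equiv> transition_mat n E rho"
      and "C \<equiv> transpose_mat N * M"
  defines "Ch \<equiv> transpose_mat Nh * Mh"
  defines "W1 \<equiv> image_of_set Mh (mat_kernel Ch)"
      and "W2 \<equiv> image_of_set Nh (mat_kernel (transpose_mat Ch))"
  shows "eigenspace_mat U (-1) = {x + y | x y. x \<in> W1 \<and> y \<in> W2}
         \<and> W1 \<inter> W2 = {0\<^sub>v m}
         \<and> int (subspace_dim m (eigenspace_mat U (-1))) = int n + int s - 2 * int (vec_space.rank n C)"
proof -
  interpret isometry_pair Mh Nh m s n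
    unfolding Mh_def Nh_def M_def N_def m_def s_def
    by (rule isometry_pair_normalized_incidence[OF assms(1)])
  have U: "U = reflection_mat Mh * reflection_mat Nh"
    unfolding U_def Mh_def Nh_def M_def N_def by (rule transition_mat_eq_reflections)
  have ChT: "transpose_mat Ch = transpose_mat Mh * Nh"
    unfolding Ch_def using A_carrier B_carrier by (simp add: transpose_mult)
  have "eigenspace_mat U (-1) = {x + y | x y. x \<in> W1 \<and> y \<in> W2}"
    unfolding U minus_one_eigenspace_eq W1_def W2_def image_of_set_def ChT unfolding Ch_def by auto
  moreover have "W1 \<inter> W2 = {0\<^sub>v m}"
    unfolding W1_def W2_def image_of_set_def ChT unfolding Ch_def
    by (rule minus_one_eigenspace_summands_inter)
  moreover have "subspace_dim m (eigenspace_mat U (-1))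
      = subspace_dim s (mat_kernel Ch) + subspace_dim n (mat_kernel (transpose_mat Ch))"
    unfolding U ChT unfolding Ch_def by (rule minus_one_eigenspace_dim)
  moreover have "vec_space.rank n Ch = vec_space.rank n C"
    unfolding Ch_def Nh_def Mh_def C_def N_def M_def by (rule rank_normalized_vertex_face_mat[OF assms(1)])
  moreover note dim_mat_kernels_transpose[OF BA_carrier, folded Ch_def]
  ultimately show ?thesis by simp
qed

end
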